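(* Let $r,m\in\mathbb{Z}$ with $0\leqslant r\leqslant m$, let $s_m(r)=\sum_{i=0}^r\binom{m}{i}$, and let $b_i=2i(r+1-i)$ and $a_i=m-2r+3i$ for $0\leqslant i\leqslant r$. Let $\mathcal{T}_j$ denote the $j$th tail of the generalized continued fraction $\mathop{\mathcal{K}}_{i=1}^{r}\frac{b_i}{a_i}$. Then $$s_m(r)\prod_{j=1}^r\mathcal{T}_j=2^r\,r!\qquad\text{and}\qquad r!\,s_m(r)=\prod_{j=1}^r(a_j+\mathcal{T}_{j+1}).$$
   Context: The tails are defined by $\mathcal{T}_{r+1}=0$ and $\mathcal{T}_j=\frac{b_j}{a_j+\mathcal{T}_{j+1}}$ for $1\leqslant j\leqslant r$, i.e. $$\mathcal{T}_j=\mathop{\mathcal{K}}_{i=j}^{r}\frac{b_i}{a_i}=\cfrac{b_j}{a_j+\cfrac{b_{j+1}}{a_{j+1}+\cfrac{\ddots}{\,a_{r-1}+\cfrac{b_r}{a_r}}}}.$$ Empty products equal $1$. *)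

theory Defs imports Complex_Main begin

definition binom_partial_sum :: "nat \<Rightarrow> nat \<Rightarrow> nat" where
  "binom_partial_sum m r = (\<Sum>i=0..r. m choose i)"

(* cf_tail b a r j is b_j/(a_j + b_{j+1}/(a_{j+1} + ... + b_r/a_r)) for j <= r.
   Only j <= r + 1 is meaningful; the value 0 for larger j merely makes the function total.
   Division by zero yields 0, so cf_tail denotes the continued fraction only if no
   denominator a_j + cf_tail b a r (Suc j) vanishes. *)
function cf_tail :: "(nat \<Rightarrow> 'a::field) \<Rightarrow> (nat \<Rightarrow> 'a) \<Rightarrow> nat \<Rightarrow> nat \<Rightarrow> 'a" where
  "cf_tail b a r j = (if j > r then 0 else b j / (a j + cf_tail b a r (Suc j)))"
  by auto
termination by (relation "measure (\<lambda>(b, a, r, j). Suc r - j)") auto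

(* the recursion equation loops as a rewrite rule *)
declare cf_tail.simps [simp del]

end

theory Submission imports Defs begin

text \<open>
  Weight the partial sum \<open>\<Sum>i\<le>r. m choose i\<close> by the binomial coefficients \<open>(r - i) choose k\<close>
  to get \<open>S k = (\<Sum>i\<le>r. (m choose i) * ((r - i) choose k))\<close>, the coefficient of \<open>x ^ (r - k)\<close> in
  \<open>(1 + x) ^ m / (1 - x) ^ (k + 1)\<close>. These numbers run from \<open>S 0\<close>, the partial sum itself,
  down to \<open>S r = 1\<close> and \<open>S (r + 1) = 0\<close>, and they satisfy the three-term recurrence
  \<open>(r - k) * S k = (m - 2 * r + 3 * (k + 1)) * S (k + 1) + 2 * (k + 2) * S (k + 2)\<close>
  (lemma \<open>weighted_sum_recurrence\<close>), whose middle coefficient is \<open>a (k + 1)\<close>. Dividing by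
  \<open>S (k + 1)\<close> turns the recurrence into the recursion of the tails: the \<open>j\<close>th tail is
  \<open>2 * j * S j / S (j - 1)\<close>, and \<open>a j\<close> plus the next tail is \<open>(r + 1 - j) * S (j - 1) / S j\<close>
  (lemmas \<open>cf_tail_eq_ratio\<close> and \<open>weighted_sum_ratio\<close>). Both products therefore telescope:
  besides the elementary factors \<open>2 * j\<close> and \<open>r + 1 - j\<close>, only \<open>S r / S 0 = 1 / S 0\<close> and
  \<open>S 0 / S r = S 0\<close> remain. All \<open>S k\<close> with \<open>k \<le> r\<close> are positive, so no denominator vanishes
  even though some partial denominators \<open>a j\<close> may be zero or negative.
\<close>

definition weighted_sum :: "nat \<Rightarrow> nat \<Rightarrow> nat \<Rightarrow> real" where
  "weighted_sum m r k = (\<Sum>i\<le>r. real (m choose i) * real ((r - i) choose k))"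

lemma weighted_sum_0: "weighted_sum m r 0 = real (binom_partial_sum m r)"
  by (simp add: weighted_sum_def binom_partial_sum_def atMost_atLeast0)

lemma weighted_sum_top: "weighted_sum m r r = 1"
proof -
  have "weighted_sum m r r = (\<Sum>i\<le>r. if i = 0 then 1 else 0)"
    unfolding weighted_sum_def by (intro sum.cong) (auto simp: binomial_eq_0)
  then show ?thesis by simp
qed

lemma weighted_sum_beyond: "k > r \<Longrightarrow> weighted_sum m r k = 0"
  unfolding weighted_sum_def by (intro sum.neutral) (auto simp: binomial_eq_0)

lemma weighted_sum_pos:
  assumes "k \<le> r"
  shows "weighted_sum m r k > 0"
  unfolding weighted_sum_def
  by (rule sum_pos2[where i = 0]) (use assms in auto)

lemma binomial_absorb_lower:
  "real (Suc i) * real (n choose Suc i) = (real n - real i) * real (n choose i)"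
proof (cases "i \<le> n")
  case True
  have "Suc i * (n choose Suc i) = (n - i) * (n choose i)"
    by (metis binomial_absorb_comp binomial_absorption mult.commute)
  then have "real (Suc i * (n choose Suc i)) = real ((n - i) * (n choose i))"
    by (rule arg_cong)
  then show ?thesis
    using True by (simp only: of_nat_mult of_nat_diff)
next
  case False
  then show ?thesis by (simp add: binomial_eq_0)
qed

text \<open>
  Since \<open>i * (m choose i) = (m - (i - 1)) * (m choose (i - 1))\<close> for \<open>i \<ge> 1\<close>, a factor \<open>i\<close> can be traded for a
  shift of the summation index; this holds for an arbitrary cofactor.
\<close>

lemma sum_index_binomial_shift:
  fixes f :: "nat \<Rightarrow> real"
  shows "(\<Sum>i\<le>r. real i * real (m choose i) * f i)
    = (\<Sum>i<r. (real m - real i) * real (m choose i) * f (Suc i))"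
proof -
  have "(\<Sum>i\<le>r. real i * real (m choose i) * f i)
      = (\<Sum>i<r. real (Suc i) * real (m choose Suc i) * f (Suc i))"
    by (simp add: sum.atMost_shift del: binomial_Suc_Suc of_nat_Suc)
  then show ?thesis
    by (simp only: binomial_absorb_lower)
qed

text \<open>
  The shift replaces \<open>(r - i) choose k\<close> by \<open>(r - i - 1) choose k\<close>, which by Pascal's rule is a
  difference of two binomial coefficients with lower index \<open>k + 1\<close>. Shifting the second one back
  produces the other \<open>i\<close> in \<open>m - 2 * i\<close>.
\<close>

lemma sum_index_binomial_raise:
  "(\<Sum>i\<le>r. real i * real (m choose i) * real ((r - i) choose k))
    = (\<Sum>i\<le>r. (real m - 2 * real i) * real (m choose i) * real ((r - i) choose Suc k))"
proof -
  let ?w = "\<lambda>i. (real m - real i) * real (m choose i)"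
  have pascal: "real ((r - Suc i) choose k)
      = real ((r - i) choose Suc k) - real ((r - Suc i) choose Suc k)" if "i < r" for i
  proof -
    have "r - i = Suc (r - Suc i)" using that by simp
    then show ?thesis by simp
  qed
  have "(\<Sum>i\<le>r. real i * real (m choose i) * real ((r - i) choose k))
      = (\<Sum>i<r. ?w i * real ((r - Suc i) choose k))"
    by (rule sum_index_binomial_shift)
  also have "\<dots> = (\<Sum>i<r. ?w i * real ((r - i) choose Suc k))
      - (\<Sum>i<r. ?w i * real ((r - Suc i) choose Suc k))"
    unfolding sum_subtractf[symmetric] by (intro sum.cong) (auto simp: pascal algebra_simps)
  also have "(\<Sum>i<r. ?w i * real ((r - Suc i) choose Suc k))
      = (\<Sum>i\<le>r. real i * real (m choose i) * real ((r - i) choose Suc k))"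
    by (rule sum_index_binomial_shift[symmetric])
  also have "(\<Sum>i<r. ?w i * real ((r - i) choose Suc k))
      = (\<Sum>i\<le>r. ?w i * real ((r - i) choose Suc k))"
    by (simp add: lessThan_Suc_atMost[symmetric])
  finally show ?thesis
    unfolding sum_subtractf[symmetric] by (simp add: algebra_simps)
qed

text \<open>
  Split the factor \<open>r - k\<close> as \<open>(r - i - k) + i\<close>. The first part raises \<open>k\<close> by absorption, the
  second by the previous lemma; the factor \<open>m - 2 * i = m - 2 * r + 2 * (r - i)\<close> left over from it
  is removed by absorption once more.
\<close>

lemma weighted_sum_recurrence:
  "(real r - real k) * weighted_sum m r k
    = (real m - 2 * real r + 3 * real (Suc k)) * weighted_sum m r (Suc k)
      + 2 * real (Suc (Suc k)) * weighted_sum m r (Suc (Suc k))"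
proof -
  let ?c = "\<lambda>i. real (m choose i)"
  let ?e = "\<lambda>i k. real ((r - i) choose k)"
  have absorb: "real (Suc k) * ?e i (Suc k) = (real r - real i - real k) * ?e i k"
    if "i \<le> r" for i k
    using binomial_absorb_lower[of k "r - i"] that by (simp only: of_nat_diff)
  have low: "(real r - real k) * (?c i * ?e i k)
      = real (Suc k) * (?c i * ?e i (Suc k)) + real i * ?c i * ?e i k" if "i \<le> r" for i
  proof -
    have "(real r - real k) * (?c i * ?e i k)
        = ?c i * ((real r - real i - real k) * ?e i k) + real i * ?c i * ?e i k"
      by (simp add: algebra_simps)
    also have "\<dots> = ?c i * (real (Suc k) * ?e i (Suc k)) + real i * ?c i * ?e i k"
      by (simp only: absorb[OF that])
    finally show ?thesis by (simp only: mult_ac)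
  qed
  have high: "(real m - 2 * real i) * ?c i * ?e i (Suc k)
      = (real m - 2 * real r + 2 * real (Suc k)) * (?c i * ?e i (Suc k))
        + 2 * real (Suc (Suc k)) * (?c i * ?e i (Suc (Suc k)))" if "i \<le> r" for i
  proof -
    have "(real m - 2 * real i) * ?c i * ?e i (Suc k)
        = (real m - 2 * real r + 2 * real (Suc k)) * (?c i * ?e i (Suc k))
          + 2 * ?c i * ((real r - real i - real (Suc k)) * ?e i (Suc k))"
      by algebra
    also have "\<dots> = (real m - 2 * real r + 2 * real (Suc k)) * (?c i * ?e i (Suc k))
          + 2 * ?c i * (real (Suc (Suc k)) * ?e i (Suc (Suc k)))"
      by (simp only: absorb[OF that])
    finally show ?thesis by (simp only: mult_ac)
  qed
  have "(real r - real k) * weighted_sum m r k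
      = (\<Sum>i\<le>r. real (Suc k) * (?c i * ?e i (Suc k)) + real i * ?c i * ?e i k)"
    unfolding weighted_sum_def sum_distrib_left by (intro sum.cong refl low) simp
  also have "\<dots> = real (Suc k) * weighted_sum m r (Suc k)
      + (\<Sum>i\<le>r. (real m - 2 * real i) * ?c i * ?e i (Suc k))"
    unfolding sum.distrib sum_index_binomial_raise weighted_sum_def sum_distrib_left by (rule refl)
  also have "(\<Sum>i\<le>r. (real m - 2 * real i) * ?c i * ?e i (Suc k))
      = (\<Sum>i\<le>r. (real m - 2 * real r + 2 * real (Suc k)) * (?c i * ?e i (Suc k))
        + 2 * real (Suc (Suc k)) * (?c i * ?e i (Suc (Suc k))))"
    by (intro sum.cong refl high) simp
  also have "\<dots> = (real m - 2 * real r + 2 * real (Suc k)) * weighted_sum m r (Suc k)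
      + 2 * real (Suc (Suc k)) * weighted_sum m r (Suc (Suc k))"
    unfolding sum.distrib weighted_sum_def sum_distrib_left by (rule refl)
  finally show ?thesis by (simp add: algebra_simps)
qed

lemma weighted_sum_ratio:
  assumes "k < r"
  shows "real m - 2 * real r + 3 * real (Suc k)
      + 2 * real (Suc (Suc k)) * weighted_sum m r (Suc (Suc k)) / weighted_sum m r (Suc k)
    = (real r - real k) * weighted_sum m r k / weighted_sum m r (Suc k)"
proof -
  have "weighted_sum m r (Suc k) \<noteq> 0"
    using weighted_sum_pos[of "Suc k" r m] assms by simp
  then show ?thesis
    unfolding weighted_sum_recurrence by (simp add: add_divide_distrib)
qed

text \<open>
  Downward induction on \<open>k\<close>. The start \<open>k = r\<close> is the empty tail, matched by \<open>S (r + 1) = 0\<close>. In the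
  step, the factor \<open>r - k\<close> of \<open>b (k + 1)\<close> cancels against the one in the recurrence.
\<close>

lemma cf_tail_eq_ratio:
  fixes a b :: "nat \<Rightarrow> real"
  assumes b: "\<And>i. i \<le> r \<Longrightarrow> b i = 2 * real i * (real r + 1 - real i)"
    and a: "\<And>i. i \<le> r \<Longrightarrow> a i = real m - 2 * real r + 3 * real i"
    and "k \<le> r"
  shows "cf_tail b a r (Suc k) = 2 * real (Suc k) * weighted_sum m r (Suc k) / weighted_sum m r k"
  using \<open>k \<le> r\<close>
proof (induction k rule: inc_induct)
  case base
  show ?case by (simp add: cf_tail.simps[of b a r "Suc r"] weighted_sum_beyond)
next
  case (step k)
  have "cf_tail b a r (Suc k) = b (Suc k) / (a (Suc k) + cf_tail b a r (Suc (Suc k)))"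
    using step.hyps by (simp add: cf_tail.simps[of b a r "Suc k"])
  also have "a (Suc k) + cf_tail b a r (Suc (Suc k))
      = (real r - real k) * weighted_sum m r k / weighted_sum m r (Suc k)"
    using a[of "Suc k"] step weighted_sum_ratio[of k r m] by simp
  also have "b (Suc k) = 2 * real (Suc k) * (real r - real k)"
    using b[of "Suc k"] step.hyps by simp
  finally show ?case
    using step.hyps by simp
qed

theorem corollary1p2:
  fixes r m :: nat and a b :: "nat \<Rightarrow> real"
  assumes "r \<le> m"
    and "\<And>i. i \<le> r \<Longrightarrow> b i = 2 * real i * (real r + 1 - real i)"
    and "\<And>i. i \<le> r \<Longrightarrow> a i = real m - 2 * real r + 3 * real i"
  shows "real (binom_partial_sum m r) * (\<Prod>j=1..r. cf_tail b a r j) = 2 ^ r * fact r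
    \<and> fact r * real (binom_partial_sum m r) = (\<Prod>j=1..r. a j + cf_tail b a r (j + 1))"
proof -
  let ?S = "weighted_sum m r"
  have tail: "cf_tail b a r (Suc k) = 2 * real (Suc k) * ?S (Suc k) / ?S k" if "k \<le> r" for k
    using assms(2,3) that by (rule cf_tail_eq_ratio)
  have nz: "?S k \<noteq> 0" if "k \<le> r" for k
    using weighted_sum_pos[OF that, of m] by simp
  have up: "(\<Prod>k<n. ?S (Suc k) / ?S k) = ?S n / ?S 0" if "n \<le> r" for n
    using that by (induction n) (simp_all add: nz)
  have down: "(\<Prod>k<n. ?S k / ?S (Suc k)) = ?S 0 / ?S n" if "n \<le> r" for n
    using that by (induction n) (simp_all add: nz)
  have fact_up: "(\<Prod>k<r. real (Suc k)) = fact r"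
    by (simp add: fact_prod_Suc atLeast0LessThan)
  have fact_down: "(\<Prod>k<r. real r - real k) = fact r"
    by (simp add: fact_prod_rev atLeast0LessThan of_nat_diff)
  have "(\<Prod>j=1..r. cf_tail b a r j) = (\<Prod>k<r. 2 * real (Suc k) * (?S (Suc k) / ?S k))"
    unfolding One_nat_def prod.atLeast1_atMost_eq by (intro prod.cong) (auto simp: tail)
  also have "\<dots> = 2 ^ r * fact r / ?S 0"
    by (simp only: prod.distrib fact_up up[OF order_refl] weighted_sum_top) simp
  finally have first: "?S 0 * (\<Prod>j=1..r. cf_tail b a r j) = 2 ^ r * fact r"
    using nz[of 0] by simp
  have "(\<Prod>j=1..r. a j + cf_tail b a r (j + 1))
      = (\<Prod>k<r. (real r - real k) * (?S k / ?S (Suc k)))"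
    unfolding One_nat_def prod.atLeast1_atMost_eq
  proof (intro prod.cong refl)
    fix k assume "k \<in> {..<r}"
    then show "a (Suc k) + cf_tail b a r (Suc k + Suc 0)
        = (real r - real k) * (?S k / ?S (Suc k))"
      using weighted_sum_ratio[of k r m] tail[of "Suc k"] assms(3)[of "Suc k"] by simp
  qed
  also have "\<dots> = fact r * ?S 0"
    by (simp only: prod.distrib fact_down down[OF order_refl] weighted_sum_top div_by_1)
  finally have second: "fact r * ?S 0 = (\<Prod>j=1..r. a j + cf_tail b a r (j + 1))" ..
  from first second show ?thesis
    by (simp only: weighted_sum_0)
qed

end
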